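(* $b\underline{\mathcal D}=b\overline{\mathcal D}=\overline{\mathcal{BD}}$.
   Context: $\mathbb N$ denotes the positive integers. For $A\subseteq\mathbb N$: lower density $\underline d(A)=\liminf_n \#\{k\le n:k\in A\}/n$, upper density $\overline d(A)=\limsup_n \#\{k\le n:k\in A\}/n$, upper Banach density $\overline{Bd}(A)=\lim_n\sup_k \#(A\cap[k,k+n])/n$. $\underline{\mathcal D}=\{A:\underline d(A)>0\}$, $\overline{\mathcal D}=\{A:\overline d(A)>0\}$, $\overline{\mathcal{BD}}=\{A:\overline{Bd}(A)>0\}$. For a family $\mathcal F$ of subsets of $\mathbb N$, the block family $b\mathcal F$ is defined by: $S\in b\mathcal F$ iff there is $F\in\mathcal F$ such that for every finite $R\subseteq F$ there is $n\in\mathbb N$ with $R+n=\{r+n:r\in R\}\subseteq S$. *)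

theory Defs
  imports "HOL-Analysis.Analysis"
begin

text \<open>Subsets of the positive integers are modelled as sets of naturals
contained in {0<..}. Densities take values in ereal (they lie in [0,1]).\<close>

definition count_upto :: "nat set \<Rightarrow> nat \<Rightarrow> nat" where
  "count_upto A n = card {k \<in> A. 1 \<le> k \<and> k \<le> n}"

definition lower_density :: "nat set \<Rightarrow> ereal" where
  "lower_density A = liminf (\<lambda>n. ereal (real (count_upto A n) / real n))"

definition upper_density :: "nat set \<Rightarrow> ereal" where
  "upper_density A = limsup (\<lambda>n. ereal (real (count_upto A n) / real n))"

definition upper_banach_density :: "nat set \<Rightarrow> ereal" where
  "upper_banach_density A =
     lim (\<lambda>n. SUP k\<in>{1..}. ereal (real (card (A \<inter> {k..k+n})) / real n))"

definition posint_sets :: "nat set set" where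
  "posint_sets = {A. A \<subseteq> {0<..}}"

definition LowerD :: "nat set set" where
  "LowerD = {A \<in> posint_sets. lower_density A > 0}"

definition UpperD :: "nat set set" where
  "UpperD = {A \<in> posint_sets. upper_density A > 0}"

definition UpperBD :: "nat set set" where
  "UpperBD = {A \<in> posint_sets. upper_banach_density A > 0}"

definition block_family :: "nat set set \<Rightarrow> nat set set" where
  "block_family \<F> = {S \<in> posint_sets. \<exists>F\<in>\<F>. \<forall>R. finite R \<and> R \<subseteq> F \<longrightarrow>
       (\<exists>n::nat. n > 0 \<and> (\<lambda>r. r + n) ` R \<subseteq> S)}"

end

theory Submission
  imports Defs
begin

text \<open>The maximal number of points of \<open>S\<close> in a window of length \<open>m\<close> is subadditive in \<open>m\<close>,
so by Fekete's lemma its ratio to \<open>m\<close> converges to its infimum, which is the upper Banach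
density. If every finite subset of \<open>F\<close> has a translate inside \<open>S\<close>, the initial segments of \<open>F\<close>
are no denser than the densest windows of \<open>S\<close>; this gives \<open>block_family UpperD \<subseteq> UpperBD\<close>.
Conversely, if the upper Banach density of \<open>S\<close> is \<open>2c > 0\<close>, there are arbitrarily long windows
all of whose prefixes have density at least \<open>c\<close>; a compactness argument (K\<ouml>nig's lemma) on
the patterns these windows trace on \<open>{1..j}\<close> yields a set \<open>F\<close> of lower density at least \<open>c\<close>
each of whose initial segments has a translate inside \<open>S\<close>; this gives
\<open>UpperBD \<subseteq> block_family LowerD\<close>, which closes the cycle of inclusions.\<close>

lemma subadditive_mult_add:
  fixes u :: "nat \<Rightarrow> real"
  assumes sub: "\<And>m n. u (m + n) \<le> u m + u n"
  shows "u (q * m + r) \<le> q * u m + u r"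
proof (induction q)
  case (Suc q)
  have "u (Suc q * m + r) \<le> u m + u (q * m + r)"
    using sub[of m "q * m + r"] by (simp add: add.assoc)
  with Suc show ?case by (simp add: algebra_simps)
qed simp

lemma Fekete_subadditive:
  fixes u :: "nat \<Rightarrow> real"
  assumes sub: "\<And>m n. u (m + n) \<le> u m + u n" and nonneg: "\<And>n. 0 \<le> u n"
  shows "(\<lambda>n. u n / n) \<longlonglongrightarrow> (INF n\<in>{1..}. u n / n)"
proof -
  have bdd: "bdd_below ((\<lambda>n. u n / n) ` {1..})"
    by (intro bdd_belowI[of _ 0]) (auto simp: nonneg)
  show ?thesis
  proof (rule order_tendstoI)
    fix a assume a: "a < (INF n\<in>{1..}. u n / n)"
    show "\<forall>\<^sub>F n in sequentially. a < u n / n"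
      using eventually_ge_at_top[of 1]
      by eventually_elim (use a cINF_lower[OF bdd] in force)
  next
    fix a assume "(INF n\<in>{1..}. u n / n) < a"
    then obtain m where m: "m \<ge> 1" "u m / m < a"
      using cInf_less_iff[OF _ bdd] by auto
    define M where "M = Max (u ` {..<m})"
    have rem: "u r \<le> M" if "r < m" for r
      unfolding M_def using that by (intro Max_ge) auto
    have "\<forall>\<^sub>F n in sequentially. M / n < a - u m / m"
      using m(2) by (intro order_tendstoD[OF lim_const_over_n]) simp
    then show "\<forall>\<^sub>F n in sequentially. u n / n < a"
      using eventually_ge_at_top[of 1]
    proof eventually_elim
      case (elim n)
      define q where "q = n div m"
      have "u n \<le> q * u m + M"
        using subadditive_mult_add[OF sub, of q m "n mod m"] rem[of "n mod m"] m(1)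
        unfolding q_def by simp
      moreover have "real (q * m) * u m \<le> real n * u m"
        unfolding q_def by (intro mult_right_mono nonneg of_nat_mono) simp
      then have "q * u m \<le> n * (u m / m)"
        using m(1) by (simp add: field_simps)
      ultimately have "u n / n \<le> u m / m + M / n"
        using elim(2) by (simp add: field_simps)
      then show ?case using elim(1) by linarith
    qed
  qed
qed

definition window_count :: "nat set \<Rightarrow> nat \<Rightarrow> nat \<Rightarrow> nat" where
  "window_count S k m = card (S \<inter> {k<..k + m})"

definition max_window_count :: "nat set \<Rightarrow> nat \<Rightarrow> nat" where
  "max_window_count S m = Max (range (\<lambda>k. window_count S k m))"

lemma window_count_le: "window_count S k m \<le> m"
  unfolding window_count_def using card_mono[of "{k<..k + m}" "S \<inter> {k<..k + m}"] by auto

lemma window_count_add: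
  "window_count S k (m + n) = window_count S k m + window_count S (k + m) n"
proof -
  have "S \<inter> {k<..k + (m + n)} = S \<inter> {k<..k + m} \<union> S \<inter> {k + m<..k + m + n}" by auto
  then show ?thesis
    unfolding window_count_def by (subst card_Un_disjoint[symmetric]) (auto simp: add.assoc)
qed

lemma count_upto_eq_card: "count_upto F n = card (F \<inter> {1..n})"
  unfolding count_upto_def by (rule arg_cong[of _ _ card]) auto

lemma window_count_eq_card_shifted:
  "window_count S s i = card {x \<in> {1..i}. x + s \<in> S}"
proof -
  have "S \<inter> {s<..s + i} = (\<lambda>x. x + s) ` {x \<in> {1..i}. x + s \<in> S}"
    by (auto simp: image_iff) (metis add.commute add_le_cancel_left less_eq_Suc_le less_imp_add_positive)
  then show ?thesis
    unfolding window_count_def by (simp add: card_image inj_on_def)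
qed

lemma finite_range_window_count: "finite (range (\<lambda>k. window_count S k m))"
  by (rule finite_subset[of _ "{..m}"]) (auto simp: window_count_le)

lemma window_count_le_max: "window_count S k m \<le> max_window_count S m"
  unfolding max_window_count_def by (rule Max_ge[OF finite_range_window_count]) simp

lemma max_window_count_attained: "\<exists>k. max_window_count S m = window_count S k m"
  using Max_in[OF finite_range_window_count] unfolding max_window_count_def by blast

lemma max_window_count_add:
  "max_window_count S (m + n) \<le> max_window_count S m + max_window_count S n"
proof -
  obtain k where "max_window_count S (m + n) = window_count S k (m + n)"
    using max_window_count_attained by blast
  then show ?thesis
    using window_count_add[of S k m n] window_count_le_max[of S k m]
      window_count_le_max[of S "k + m" n] by simp
qed

definition window_density :: "nat set \<Rightarrow> real" where
  "window_density S = (INF m\<in>{1..}. real (max_window_count S m) / m)"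

lemma max_window_count_ratio_tendsto:
  "(\<lambda>m. real (max_window_count S m) / m) \<longlonglongrightarrow> window_density S"
  unfolding window_density_def
  by (rule Fekete_subadditive) (simp_all add: max_window_count_add flip: of_nat_add)

lemma window_density_le: "m \<ge> 1 \<Longrightarrow> window_density S \<le> real (max_window_count S m) / m"
  unfolding window_density_def by (rule cINF_lower) (auto intro!: bdd_belowI[of _ 0])

lemma upper_banach_density_eq_window_density:
  "upper_banach_density S = ereal (window_density S)"
proof -
  txt \<open>The window \<open>{k..k+n}\<close> in the definition has \<open>n + 1\<close> elements but is divided by \<open>n\<close>.\<close>
  have closed_window: "card (S \<inter> {k..k + n}) = window_count S (k - 1) (Suc n)"
    if "k \<ge> 1" for k n
  proof -
    have "{k - 1<..k - 1 + Suc n} = {k..k + n}" using that by auto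
    then show ?thesis unfolding window_count_def by simp
  qed
  have sup: "(SUP k\<in>{1..}. ereal (card (S \<inter> {k..k + n}) / n))
      = ereal (max_window_count S (Suc n) / n)" for n
  proof (rule SUP_eqI)
    fix k :: nat assume "k \<in> {1..}"
    then show "ereal (card (S \<inter> {k..k + n}) / n) \<le> ereal (max_window_count S (Suc n) / n)"
      using closed_window window_count_le_max by (simp add: divide_right_mono)
  next
    fix y assume y: "\<And>k. k \<in> {1..} \<Longrightarrow> ereal (card (S \<inter> {k..k + n}) / n) \<le> y"
    obtain k where "max_window_count S (Suc n) = window_count S k (Suc n)"
      using max_window_count_attained by blast
    then show "ereal (max_window_count S (Suc n) / n) \<le> y"
      using y[of "Suc k"] closed_window[of "Suc k" n] by simp
  qed
  have "(\<lambda>n. real (max_window_count S (Suc n)) / Suc n * (Suc n / n)) \<longlonglongrightarrow> window_density S * 1"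
    by (intro tendsto_mult LIMSEQ_Suc[OF max_window_count_ratio_tendsto] LIMSEQ_Suc_n_over_n)
  moreover have "\<forall>\<^sub>F n in sequentially.
      real (max_window_count S (Suc n)) / Suc n * (Suc n / n) = max_window_count S (Suc n) / n"
    using eventually_gt_at_top[of "0::nat"] by eventually_elim simp
  ultimately have "(\<lambda>n. real (max_window_count S (Suc n)) / n) \<longlonglongrightarrow> window_density S"
    using Lim_transform_eventually by fastforce
  then show ?thesis
    unfolding upper_banach_density_def sup by (intro limI tendsto_ereal)
qed

lemma upper_density_le_window_density:
  assumes "\<And>n. count_upto F n \<le> max_window_count S n"
  shows "upper_density F \<le> ereal (window_density S)"
proof -
  have "upper_density F \<le> limsup (\<lambda>n. ereal (max_window_count S n / n))"
    unfolding upper_density_def using assms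
    by (intro Limsup_mono always_eventually allI) (simp add: divide_right_mono)
  also have "\<dots> = ereal (window_density S)"
    by (intro lim_imp_Limsup trivial_limit_sequentially tendsto_ereal
        max_window_count_ratio_tendsto)
  finally show ?thesis .
qed

lemma lower_density_ge:
  fixes c :: real
  assumes "\<And>n. c * n \<le> count_upto F n"
  shows "ereal c \<le> lower_density F"
  unfolding lower_density_def
proof (rule Liminf_bounded)
  show "\<forall>\<^sub>F n in sequentially. ereal c \<le> ereal (count_upto F n / n)"
    using eventually_gt_at_top[of "0::nat"]
    by eventually_elim (use assms in \<open>simp add: field_simps\<close>)
qed

lemma count_upto_le_max_window_count:
  assumes "\<And>R. finite R \<Longrightarrow> R \<subseteq> F \<Longrightarrow> \<exists>t. (\<lambda>r. r + t) ` R \<subseteq> S"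
  shows "count_upto F n \<le> max_window_count S n"
proof -
  obtain t where t: "(\<lambda>r. r + t) ` (F \<inter> {1..n}) \<subseteq> S"
    using assms[of "F \<inter> {1..n}"] by auto
  have "count_upto F n = card ((\<lambda>r. r + t) ` (F \<inter> {1..n}))"
    by (simp add: count_upto_eq_card card_image)
  also have "\<dots> \<le> window_count S t n"
    unfolding window_count_def using t by (intro card_mono) auto
  also have "\<dots> \<le> max_window_count S n"
    by (rule window_count_le_max)
  finally show ?thesis .
qed

text \<open>Take a window of length \<open>m\<close> with at least \<open>2cm\<close> points and cut it at the position \<open>j0\<close>
minimising \<open>count - c\<cdot>j\<close>: every prefix of the remaining window has density at least \<open>c\<close>, and the
remainder is longer than \<open>cm - 1\<close>.\<close>

lemma window_with_dense_prefixes: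
  fixes c :: real
  assumes c: "c > 0" and dense: "\<And>m. m \<ge> 1 \<Longrightarrow> 2 * c * m \<le> max_window_count S m"
  shows "\<exists>s>0. \<forall>i\<le>L. c * i \<le> window_count S s i"
proof -
  obtain m :: nat where "(real L + 1) / c < m"
    using reals_Archimedean2 by blast
  then have cm: "real L + 1 < c * m"
    using c by (simp add: field_simps)
  then have m: "m \<ge> 1"
    using c by (cases m) auto
  obtain k where k: "max_window_count S m = window_count S k m"
    using max_window_count_attained by blast
  define f where "f j = real (window_count S k j) - c * j" for j
  define j0 where "j0 = arg_min_on f {1..m}"
  have j0: "j0 \<in> {1..m}" and min: "\<And>j. j \<in> {1..m} \<Longrightarrow> f j0 \<le> f j"
    using arg_min_if_finite[of "{1..m}" f] m unfolding j0_def by (auto simp: not_less)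
  have "f j0 \<le> 1 - c"
    using min[of 1] m window_count_le[of S k 1] unfolding f_def by simp
  moreover have "window_count S k m + j0 \<le> window_count S k j0 + m"
    using window_count_add[of S k j0 "m - j0"] window_count_le[of S "k + j0" "m - j0"] j0
    by auto
  then have "real (window_count S k m) + j0 \<le> window_count S k j0 + m"
    by (simp flip: of_nat_add)
  moreover have "c * j0 \<le> c * m"
    using c j0 by simp
  ultimately have "real L + j0 \<le> m"
    using dense[OF m] k cm c unfolding f_def by linarith
  then have "L \<le> m - j0"
    by linarith
  show ?thesis
  proof (intro exI[of _ "k + j0"] conjI allI impI)
    show "k + j0 > 0" using j0 by simp
    fix i assume "i \<le> L"
    then have "f j0 \<le> f (j0 + i)"
      using \<open>L \<le> m - j0\<close> j0 by (intro min) auto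
    then show "c * i \<le> window_count S (k + j0) i"
      unfolding f_def window_count_add by (simp add: algebra_simps)
  qed
qed

text \<open>The patterns traced on \<open>{1..j}\<close> by arbitrarily long windows with dense prefixes form a
finitely branching tree in which every node has a child (\<open>dense_pattern_extend\<close>);
\<open>dense_pattern_seq\<close> follows one infinite branch.\<close>

definition dense_pattern :: "nat set \<Rightarrow> real \<Rightarrow> nat \<Rightarrow> nat set \<Rightarrow> bool" where
  "dense_pattern S c j P \<longleftrightarrow>
     (\<forall>L. \<exists>s>0. (\<forall>i\<le>L. c * real i \<le> window_count S s i) \<and> {x \<in> {1..j}. x + s \<in> S} = P)"

lemma dense_pattern_extend:
  assumes "dense_pattern S c j P"
  shows "dense_pattern S c (Suc j) (insert (Suc j) P) \<or> dense_pattern S c (Suc j) P"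
proof -
  have "(\<exists>s>0. (\<forall>i\<le>L1. c * i \<le> window_count S s i) \<and>
           {x \<in> {1..Suc j}. x + s \<in> S} = insert (Suc j) P) \<or>
        (\<exists>s>0. (\<forall>i\<le>L2. c * i \<le> window_count S s i) \<and>
           {x \<in> {1..Suc j}. x + s \<in> S} = P)" for L1 L2
  proof -
    obtain s where s: "s > 0" "\<forall>i\<le>max L1 L2. c * i \<le> window_count S s i"
      and P: "{x \<in> {1..j}. x + s \<in> S} = P"
      using assms unfolding dense_pattern_def by blast
    have "{x \<in> {1..Suc j}. x + s \<in> S} = (if Suc j + s \<in> S then insert (Suc j) P else P)"
      using P by (auto simp: le_Suc_eq)
    then show ?thesis
      using s by (auto split: if_splits)
  qed
  then show ?thesis
    unfolding dense_pattern_def by blast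
qed

primrec dense_pattern_seq :: "nat set \<Rightarrow> real \<Rightarrow> nat \<Rightarrow> nat set" where
  "dense_pattern_seq S c 0 = {}"
| "dense_pattern_seq S c (Suc j) =
     (if dense_pattern S c (Suc j) (insert (Suc j) (dense_pattern_seq S c j))
      then insert (Suc j) (dense_pattern_seq S c j) else dense_pattern_seq S c j)"

lemma dense_pattern_seq_subset: "dense_pattern_seq S c j \<subseteq> {1..j}"
  by (induction j) auto

lemma dense_pattern_dense_pattern_seq:
  assumes "dense_pattern S c 0 {}"
  shows "dense_pattern S c j (dense_pattern_seq S c j)"
proof (induction j)
  case (Suc j)
  then show ?case
    using dense_pattern_extend[OF Suc] by auto
qed (use assms in simp)

lemma mem_dense_pattern_seq_iff:
  "x \<in> dense_pattern_seq S c j \<longleftrightarrow> x \<in> dense_pattern_seq S c x \<and> x \<le> j"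
proof (induction j)
  case (Suc j)
  then show ?case
    using dense_pattern_seq_subset[of S c j] by (auto simp: le_Suc_eq)
qed (use dense_pattern_seq_subset in fastforce)

lemma set_with_dense_translates:
  fixes c :: real
  assumes c: "c > 0" and dense: "\<And>m. m \<ge> 1 \<Longrightarrow> 2 * c * m \<le> max_window_count S m"
  obtains F where "F \<subseteq> {0<..}" and "\<And>n. c * n \<le> count_upto F n"
    and "\<And>R. finite R \<Longrightarrow> R \<subseteq> F \<Longrightarrow> \<exists>s>0. (\<lambda>r. r + s) ` R \<subseteq> S"
proof
  define F where "F = {x. x \<in> dense_pattern_seq S c x}"
  have F_restrict: "F \<inter> {1..j} = dense_pattern_seq S c j" for j
    using mem_dense_pattern_seq_iff[of _ S c j] dense_pattern_seq_subset[of S c j]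
    unfolding F_def by auto
  have "dense_pattern S c 0 {}"
    using window_with_dense_prefixes[OF c dense] unfolding dense_pattern_def by auto
  then have "dense_pattern S c j (F \<inter> {1..j})" for j
    unfolding F_restrict by (rule dense_pattern_dense_pattern_seq)
  then have shift: "\<exists>s>0. (\<forall>i\<le>j. c * i \<le> window_count S s i) \<and>
      {x \<in> {1..j}. x + s \<in> S} = F \<inter> {1..j}" for j
    unfolding dense_pattern_def by (rule spec)
  show F_pos: "F \<subseteq> {0<..}"
    using dense_pattern_seq_subset unfolding F_def by fastforce
  show "c * n \<le> count_upto F n" for n
  proof -
    obtain s where dense_s: "\<forall>i\<le>n. c * i \<le> window_count S s i"
      and pattern: "{x \<in> {1..n}. x + s \<in> S} = F \<inter> {1..n}"
      using shift[of n] by blast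
    have "c * n \<le> window_count S s n"
      using dense_s by simp
    also have "\<dots> = count_upto F n"
      unfolding count_upto_eq_card window_count_eq_card_shifted pattern ..
    finally show ?thesis .
  qed
  show "\<exists>s>0. (\<lambda>r. r + s) ` R \<subseteq> S" if R: "finite R" "R \<subseteq> F" for R
  proof -
    obtain j where "R \<subseteq> {..j}"
      using R(1) finite_nat_iff_bounded_le by blast
    with R(2) F_pos have "R \<subseteq> F \<inter> {1..j}"
      by (force simp: Suc_le_eq)
    moreover obtain s where "s > 0" "{x \<in> {1..j}. x + s \<in> S} = F \<inter> {1..j}"
      using shift[of j] by blast
    ultimately show ?thesis
      by blast
  qed
qed

lemma LowerD_subset_UpperD: "LowerD \<subseteq> UpperD"
proof
  fix A assume "A \<in> LowerD"
  moreover have "lower_density A \<le> upper_density A"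
    unfolding lower_density_def upper_density_def by (rule Liminf_le_Limsup) simp
  ultimately show "A \<in> UpperD"
    unfolding LowerD_def UpperD_def by auto
qed

lemma block_family_mono: "\<F> \<subseteq> \<G> \<Longrightarrow> block_family \<F> \<subseteq> block_family \<G>"
  unfolding block_family_def by auto

lemma block_family_UpperD_subset_UpperBD: "block_family UpperD \<subseteq> UpperBD"
proof
  fix S assume "S \<in> block_family UpperD"
  then obtain F where S: "S \<in> posint_sets" and F: "F \<in> UpperD"
    and blocks: "\<forall>R. finite R \<and> R \<subseteq> F \<longrightarrow> (\<exists>t>0. (\<lambda>r. r + t) ` R \<subseteq> S)"
    unfolding block_family_def by auto
  have "upper_density F \<le> upper_banach_density S"
    unfolding upper_banach_density_eq_window_density
    using blocks by (intro upper_density_le_window_density count_upto_le_max_window_count) blast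
  with S F show "S \<in> UpperBD"
    unfolding UpperD_def UpperBD_def by auto
qed

lemma UpperBD_subset_block_family_LowerD: "UpperBD \<subseteq> block_family LowerD"
proof
  fix S assume "S \<in> UpperBD"
  then have S: "S \<in> posint_sets" and "window_density S > 0"
    unfolding UpperBD_def upper_banach_density_eq_window_density by auto
  then have pos: "window_density S / 2 > 0" by simp
  have dense: "2 * (window_density S / 2) * m \<le> max_window_count S m" if "m \<ge> 1" for m
    using window_density_le[OF that, of S] that by (simp add: field_simps)
  obtain F where F: "F \<subseteq> {0<..}" and dense_F: "\<And>n. window_density S / 2 * n \<le> count_upto F n"
    and blocks: "\<And>R. finite R \<Longrightarrow> R \<subseteq> F \<Longrightarrow> \<exists>s>0. (\<lambda>r. r + s) ` R \<subseteq> S"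
    using set_with_dense_translates[OF pos dense] by blast
  have "0 < ereal (window_density S / 2)"
    using pos by simp
  also have "\<dots> \<le> lower_density F"
    by (rule lower_density_ge[OF dense_F])
  finally have "0 < lower_density F" .
  with F have "F \<in> LowerD"
    unfolding LowerD_def posint_sets_def by blast
  with S blocks show "S \<in> block_family LowerD"
    unfolding block_family_def by blast
qed

theorem mainTheorem2:
  shows "block_family LowerD = block_family UpperD \<and> block_family UpperD = UpperBD"
  using block_family_mono[OF LowerD_subset_UpperD] block_family_UpperD_subset_UpperBD
    UpperBD_subset_block_family_LowerD
  by blast

end
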